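(* Let $\mathcal{C}_0\supset\mathcal{C}$ be an open convex set in $\mathcal{L}_n$, and let $\mathcal{F}:\mathcal{C}_0\to\mathcal{L}_n$ (of the form $\mathcal{F}(x(\cdot))(\xi)=F(x(\xi),\xi)$) be continuously differentiable and pseudomonotone on $\mathcal{C}_0$. Let $D\hat{F}(x)$ be symmetric for all $x\in\phi(\mathcal{C}_0)$. If $e_3>0$ satisfies the following conditions for all $i=1,2,\dots,\bar n$ and all $x\in\phi(\mathcal{C}_0)$: (i) $(D\hat{F}(x))_{ii}+e_3(P_{\phi(\mathcal{M}_n)})_{ii}>0$; (ii) $D\hat{F}(x)+e_3P_{\phi(\mathcal{M}_n)}$ is strictly diagonally dominant, i.e. $$(D\hat{F}(x))_{ii}+e_3(P_{\phi(\mathcal{M}_n)})_{ii}>\sum_{j\ne i}\big|(D\hat{F}(x))_{ij}+e_3(P_{\phi(\mathcal{M}_n)})_{ij}\big|,$$ then the monotonicity of $\mathcal{F}+N_{\mathcal{C}}$ is globally elicited at every level $s\ge e_3$.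
   Context: Let $N\ge1$ and $n_1,\dots,n_N\ge 1$ be integers, $n=\sum_{k=1}^N n_k$. Let $\Xi=\Xi_1\times\cdots\times\Xi_N=\{\xi^1,\dots,\xi^J\}$ be a finite sample space whose elements $\xi=(\xi_1,\dots,\xi_N)$ have probabilities $p(\xi)>0$ summing to $1$. $\mathcal{L}_n$ is the Hilbert space of all maps $x(\cdot):\Xi\to\mathbb{R}^n$, $x(\xi)=(x_1(\xi),\dots,x_N(\xi))$ with $x_k(\xi)\in\mathbb{R}^{n_k}$, with inner product $\langle x(\cdot),w(\cdot)\rangle=\sum_{\xi\in\Xi}p(\xi)\sum_{k=1}^N\langle x_k(\xi),w_k(\xi)\rangle$. Let $\mathcal{N}_n=\{x(\cdot)\in\mathcal{L}_n: x_k(\xi)\text{ does not depend on }\xi_k,\dots,\xi_N,\ k=1,\dots,N\}$, and let $\mathcal{M}_n=\{w(\cdot)\in\mathcal{L}_n:E_{\xi|\xi_1,\dots,\xi_{k-1}}w_k(\xi)=0,\ k=1,\dots,N\}$ be its orthogonal complement. For each $\xi$ let $C(\xi)\subset\mathbb{R}^n$ be nonempty closed convex, and $\mathcal{C}=\{x(\cdot)\in\mathcal{L}_n:x(\xi)\in C(\xi)\ \forall\xi\in\Xi\}$. $\mathcal{F}$ is given by $\mathcal{F}(x(\cdot)):\xi\mapsto F(x(\xi),\xi)$, with $F(\cdot,\xi)$ a function from $\mathbb{R}^n$ to $\mathbb{R}^n$. $\mathcal{F}$ is pseudomonotone on $\mathcal{K}\subset\mathcal{L}_n$ if for all $x(\cdot),y(\cdot)\in\mathcal{K}$: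 $\langle y(\cdot)-x(\cdot),\mathcal{F}(x(\cdot))\rangle\ge0$ implies $\langle y(\cdot)-x(\cdot),\mathcal{F}(y(\cdot))\rangle\ge0$. Let $\bar n=nJ$ and $\phi:\mathcal{L}_n\to\mathbb{R}^{\bar n}$, $\phi(x(\cdot))=(x_{p_1}^T,\dots,x_{p_J}^T)^T$ with $x_{p_i}=\sqrt{p(\xi^i)}\,x(\xi^i)$ (a linear isometric isomorphism). Define $\hat F(x)=\big(\sqrt{p(\xi^i)}\,F(x_{p_i}/\sqrt{p(\xi^i)},\xi^i)\big)_{i=1}^J$ for $x=(x_{p_1}^T,\dots,x_{p_J}^T)^T$, so $\hat F(\phi(x(\cdot)))=\phi(\mathcal{F}(x(\cdot)))$. $D\hat F(x)$ is the Jacobian; $P_{\mathcal{M}_n}$ and $P_{\phi(\mathcal{M}_n)}$ are the orthogonal projections onto $\mathcal{M}_n$ and $\phi(\mathcal{M}_n)$ (the latter viewed as an $\bar n\times\bar n$ matrix). $N_{\mathcal{C}}(x(\cdot))=\{v(\cdot):\langle v(\cdot),y(\cdot)-x(\cdot)\rangle\le0\ \forall y(\cdot)\in\mathcal{C}\}$ for $x(\cdot)\in\mathcal{C}$, and $\emptyset$ for $x(\cdot)\notin\mathcal{C}$. The monotonicity of $\mathcal{F}+N_{\mathcal{C}}$ is (globally) elicited at level $s>0$ (with respect to $\mathcal{N}_n$) if the set-valued mapping $\mathcal{F}+N_{\mathcal{C}}+sP_{\mathcal{M}_n}$ is (globally) maximal monotone on $\mathcal{L}_n$. *)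

theory Defs
  imports "HOL-Analysis.Analysis"
begin

text \<open>
  Conventions. A scenario is a function \<open>\<xi> :: nat \<Rightarrow> 'a\<close> whose component \<open>\<xi>\<^sub>k\<close> is \<open>\<xi> k\<close>
  for \<open>k \<in> {1..N}\<close>; the sample space is the set-theoretic product \<open>PiE {1..N} \<Xi>\<close>. The finite type
  \<open>'j\<close> plays the role of \<open>{1, \<dots>, J}\<close> and \<open>xi :: 'j \<Rightarrow> nat \<Rightarrow> 'a\<close> enumerates the sample space
  bijectively. A map \<open>x(\<cdot>)\<close> from the sample space to \<open>\<real>\<^sup>n\<close> is the vector
  \<open>x :: real ^ 'n ^ 'j\<close> of its values, \<open>x $ i = x(\<xi>\<^sup>i)\<close>. The coordinates \<open>'n\<close> of \<open>\<real>\<^sup>n\<close> are split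
  into blocks by \<open>stage :: 'n \<Rightarrow> nat\<close>: \<open>x\<^sub>k\<close> consists of the coordinates \<open>c\<close> with \<open>stage c = k\<close>, so
  \<open>n\<^sub>k\<close> is the number of these. Open sets and derivatives refer to the standard norm of
  \<open>real ^ 'n ^ 'j\<close>, which is equivalent to the one of the weighted inner product \<open>inner_L\<close>.
\<close>

definition scenario_space ::
    "nat \<Rightarrow> (nat \<Rightarrow> 'a set) \<Rightarrow> ('j::finite \<Rightarrow> nat \<Rightarrow> 'a) \<Rightarrow> ((nat \<Rightarrow> 'a) \<Rightarrow> real) \<Rightarrow> bool" where
  "scenario_space N \<Xi> xi p \<longleftrightarrow>
     (\<forall>k\<in>{1..N}. finite (\<Xi> k)) \<and>
     bij_betw xi UNIV (PiE {1..N} \<Xi>) \<and>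
     (\<forall>\<xi>\<in>PiE {1..N} \<Xi>. 0 < p \<xi>) \<and>
     (\<Sum>\<xi>\<in>PiE {1..N} \<Xi>. p \<xi>) = 1"

definition inner_L ::
    "('j::finite \<Rightarrow> 's) \<Rightarrow> ('s \<Rightarrow> real) \<Rightarrow> real^'n^'j \<Rightarrow> real^'n^'j \<Rightarrow> real" where
  "inner_L xi p x w = (\<Sum>i\<in>UNIV. p (xi i) * (x $ i \<bullet> w $ i))"

definition same_history :: "('j::finite \<Rightarrow> nat \<Rightarrow> 'a) \<Rightarrow> nat \<Rightarrow> 'j \<Rightarrow> 'j set" where
  "same_history xi k i = {i'. \<forall>l\<in>{1..<k}. xi i' l = xi i l}"

definition nonanticipative ::
    "('j::finite \<Rightarrow> nat \<Rightarrow> 'a) \<Rightarrow> ('n \<Rightarrow> nat) \<Rightarrow> (real^'n^'j) set" where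
  "nonanticipative xi stage =
     {x. \<forall>c i. \<forall>i'\<in>same_history xi (stage c) i. x $ i' $ c = x $ i $ c}"

text \<open>\<open>cond_expect xi p k f i\<close> is the value at \<open>\<xi>\<^sup>i\<close> of the conditional expectation of \<open>f\<close> given
  \<open>\<xi>\<^sub>1, \<dots>, \<xi>\<^sub>k\<^sub>-\<^sub>1\<close>.\<close>

definition cond_expect ::
    "('j::finite \<Rightarrow> nat \<Rightarrow> 'a) \<Rightarrow> ((nat \<Rightarrow> 'a) \<Rightarrow> real) \<Rightarrow> nat \<Rightarrow> ('j \<Rightarrow> real) \<Rightarrow> 'j \<Rightarrow> real" where
  "cond_expect xi p k f i =
     (\<Sum>i'\<in>same_history xi k i. p (xi i') * f i') / (\<Sum>i'\<in>same_history xi k i. p (xi i'))"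

definition multipliers ::
    "('j::finite \<Rightarrow> nat \<Rightarrow> 'a) \<Rightarrow> ((nat \<Rightarrow> 'a) \<Rightarrow> real) \<Rightarrow> ('n \<Rightarrow> nat) \<Rightarrow> (real^'n^'j) set" where
  "multipliers xi p stage =
     {w. \<forall>c i. cond_expect xi p (stage c) (\<lambda>i'. w $ i' $ c) i = 0}"

text \<open>Orthogonal projection onto a subspace \<open>S\<close> with respect to the inner product \<open>ip\<close>.\<close>

definition orth_proj ::
    "('v::real_vector \<Rightarrow> 'v \<Rightarrow> real) \<Rightarrow> 'v set \<Rightarrow> 'v \<Rightarrow> 'v" where
  "orth_proj ip S x = (THE y. y \<in> S \<and> (\<forall>z\<in>S. ip (x - y) z = 0))"

definition constraint_set ::
    "('j::finite \<Rightarrow> 's) \<Rightarrow> ('s \<Rightarrow> (real^'n) set) \<Rightarrow> (real^'n^'j) set" where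
  "constraint_set xi C = {x. \<forall>i. x $ i \<in> C (xi i)}"

definition response ::
    "('j::finite \<Rightarrow> 's) \<Rightarrow> (real^'n \<Rightarrow> 's \<Rightarrow> real^'n) \<Rightarrow> real^'n^'j \<Rightarrow> real^'n^'j" where
  "response xi F x = (\<chi> i. F (x $ i) (xi i))"

definition pseudomonotone_on ::
    "('v::real_vector \<Rightarrow> 'v \<Rightarrow> real) \<Rightarrow> 'v set \<Rightarrow> ('v \<Rightarrow> 'v) \<Rightarrow> bool" where
  "pseudomonotone_on ip K f \<longleftrightarrow>
     (\<forall>x\<in>K. \<forall>y\<in>K. 0 \<le> ip (y - x) (f x) \<longrightarrow> 0 \<le> ip (y - x) (f y))"

definition continuously_differentiable_on ::
    "('v::real_normed_vector \<Rightarrow> 'w::real_normed_vector) \<Rightarrow> 'v set \<Rightarrow> bool" where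
  "continuously_differentiable_on f S \<longleftrightarrow>
     (\<exists>f' :: 'v \<Rightarrow> 'v \<Rightarrow>\<^sub>L 'w.
        (\<forall>x\<in>S. (f has_derivative blinfun_apply (f' x)) (at x)) \<and> continuous_on S f')"

definition normal_cone ::
    "('v::real_vector \<Rightarrow> 'v \<Rightarrow> real) \<Rightarrow> 'v set \<Rightarrow> 'v \<Rightarrow> 'v set" where
  "normal_cone ip K x = (if x \<in> K then {v. \<forall>y\<in>K. ip v (y - x) \<le> 0} else {})"

definition monotone_mapping ::
    "('v::real_vector \<Rightarrow> 'v \<Rightarrow> real) \<Rightarrow> ('v \<Rightarrow> 'v set) \<Rightarrow> bool" where
  "monotone_mapping ip T \<longleftrightarrow>
     (\<forall>x y. \<forall>u\<in>T x. \<forall>v\<in>T y. 0 \<le> ip (x - y) (u - v))"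

definition maximal_monotone_mapping ::
    "('v::real_vector \<Rightarrow> 'v \<Rightarrow> real) \<Rightarrow> ('v \<Rightarrow> 'v set) \<Rightarrow> bool" where
  "maximal_monotone_mapping ip T \<longleftrightarrow>
     monotone_mapping ip T \<and>
     (\<forall>T'. monotone_mapping ip T' \<and> (\<forall>x. T x \<subseteq> T' x) \<longrightarrow> T' = T)"

definition globally_elicited ::
    "('j::finite \<Rightarrow> nat \<Rightarrow> 'a) \<Rightarrow> ((nat \<Rightarrow> 'a) \<Rightarrow> real) \<Rightarrow> ('n::finite \<Rightarrow> nat) \<Rightarrow>
     (real^'n^'j \<Rightarrow> real^'n^'j) \<Rightarrow> (real^'n^'j) set \<Rightarrow> real \<Rightarrow> bool" where
  "globally_elicited xi p stage f K s \<longleftrightarrow>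
     0 < s \<and>
     maximal_monotone_mapping (inner_L xi p)
       (\<lambda>x. {f x + v + s *\<^sub>R orth_proj (inner_L xi p) (multipliers xi p stage) x | v.
              v \<in> normal_cone (inner_L xi p) K x})"

text \<open>\<open>phi\<close> is the isometry \<open>\<phi>\<close> and \<open>embedded_response\<close> is the map written \<open>F\<close> with a hat. The
  coordinates of the Euclidean space of dimension \<open>n J\<close> are indexed by \<open>'j \<times> 'n\<close>: the pair \<open>(i, c)\<close>
  denotes coordinate \<open>c\<close> of the \<open>i\<close>-th block.\<close>

definition phi ::
    "('j::finite \<Rightarrow> 's) \<Rightarrow> ('s \<Rightarrow> real) \<Rightarrow> real^'n^'j \<Rightarrow> real^('j \<times> 'n)" where
  "phi xi p x = (\<chi> a. sqrt (p (xi (fst a))) * x $ fst a $ snd a)"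

definition embedded_response ::
    "('j::finite \<Rightarrow> 's) \<Rightarrow> ('s \<Rightarrow> real) \<Rightarrow> (real^'n \<Rightarrow> 's \<Rightarrow> real^'n) \<Rightarrow>
     real^('j \<times> 'n) \<Rightarrow> real^('j \<times> 'n)" where
  "embedded_response xi p F x =
     (\<chi> a. sqrt (p (xi (fst a))) *
       F (\<chi> c. x $ (fst a, c) / sqrt (p (xi (fst a)))) (xi (fst a)) $ snd a)"

definition multiplier_projection_matrix ::
    "('j::finite \<Rightarrow> nat \<Rightarrow> 'a) \<Rightarrow> ((nat \<Rightarrow> 'a) \<Rightarrow> real) \<Rightarrow> ('n::finite \<Rightarrow> nat) \<Rightarrow>
     real^('j \<times> 'n)^('j \<times> 'n)" where
  "multiplier_projection_matrix xi p stage =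
     matrix (orth_proj (\<bullet>) (phi xi p ` multipliers xi p stage))"

text \<open>As a check of the definitions: \<open>F\<close>-hat is the conjugate of \<open>response\<close> by the isometry \<open>\<phi>\<close>, and \<open>multipliers\<close> is the
  orthogonal complement of \<open>nonanticipative\<close>.\<close>

lemma scenario_prob_pos: "scenario_space N \<Xi> xi p \<Longrightarrow> 0 < p (xi i)"
  unfolding scenario_space_def by (metis UNIV_I bij_betwE)

lemma inner_phi:
  assumes "scenario_space N \<Xi> xi p"
  shows "phi xi p x \<bullet> phi xi p w = inner_L xi p x w"
proof -
  have *: "sqrt (p (xi i)) * a * (sqrt (p (xi i)) * b) = p (xi i) * (a * b)" for i and a b :: real
  proof -
    have "sqrt (p (xi i)) * sqrt (p (xi i)) = p (xi i)"
      using scenario_prob_pos[OF assms, of i] by simp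
    then show ?thesis by (metis mult.assoc mult.left_commute)
  qed
  show ?thesis
    by (simp add: inner_vec_def phi_def inner_L_def sum_distrib_left * UNIV_Times_UNIV[symmetric]
        sum.cartesian_product' del: UNIV_Times_UNIV)
qed

lemma embedded_response_phi:
  assumes "scenario_space N \<Xi> xi p"
  shows "embedded_response xi p F (phi xi p x) = phi xi p (response xi F x)"
proof -
  have "(\<chi> c. sqrt (p (xi i)) * x $ i $ c / sqrt (p (xi i))) = x $ i" for i
    using scenario_prob_pos[OF assms, of i] by (simp add: vec_eq_iff)
  then show ?thesis
    by (simp add: embedded_response_def phi_def response_def vec_eq_iff)
qed

lemma multipliers_eq_orthogonal_complement:
  fixes xi :: "'j::finite \<Rightarrow> nat \<Rightarrow> 'a" and stage :: "'n::finite \<Rightarrow> nat"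
  assumes "scenario_space N \<Xi> xi p"
  shows "multipliers xi p stage = {w. \<forall>x\<in>nonanticipative xi stage. inner_L xi p x w = 0}"
proof -
  let ?H = "same_history xi"
  define P where "P k i = (\<Sum>i'\<in>?H k i. p (xi i'))" for k i
  have sym: "i' \<in> ?H k i \<longleftrightarrow> i \<in> ?H k i'" for k i i'
    by (auto simp: same_history_def)
  have col: "{i. i' \<in> ?H k i} = ?H k i'" for k i'
    using sym by blast
  have same: "?H k i' = ?H k i" if "i' \<in> ?H k i" for k i i'
    using that by (auto simp: same_history_def)
  have pos: "0 < P k i" for k i
    unfolding P_def by (rule sum_pos) (auto simp: same_history_def scenario_prob_pos[OF assms])
  have M: "w \<in> multipliers xi p stage \<longleftrightarrow>
      (\<forall>c i. (\<Sum>i'\<in>?H (stage c) i. p (xi i') * w $ i' $ c) = 0)" for w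
    using pos unfolding multipliers_def cond_expect_def P_def by (auto simp: less_le)
  have ipL: "inner_L xi p x w = (\<Sum>c\<in>UNIV. \<Sum>i\<in>UNIV. p (xi i) * (x $ i $ c * w $ i $ c))" for x w
    unfolding inner_L_def inner_vec_def by (simp add: sum_distrib_left) (rule sum.swap)
  have "inner_L xi p x w = 0"
    if w: "w \<in> multipliers xi p stage" and x: "x \<in> nonanticipative xi stage" for w x
  proof -
    have "(\<Sum>i\<in>UNIV. p (xi i) * (x $ i $ c * w $ i $ c)) = 0" for c
    proof -
      let ?k = "stage c"
      let ?f = "\<lambda>i. p (xi i) * (x $ i $ c * w $ i $ c)"
      have "(\<Sum>i\<in>UNIV. ?f i) = (\<Sum>i\<in>UNIV. \<Sum>i'\<in>?H ?k i. p (xi i') * (?f i / P ?k i))"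
      proof (intro sum.cong refl)
        fix i
        have "(\<Sum>i'\<in>?H ?k i. p (xi i') * (?f i / P ?k i)) = P ?k i * (?f i / P ?k i)"
          unfolding P_def by (rule sum_distrib_right[symmetric])
        then show "?f i = (\<Sum>i'\<in>?H ?k i. p (xi i') * (?f i / P ?k i))"
          using pos[of ?k i] by simp
      qed
      also have "\<dots> = (\<Sum>i'\<in>UNIV. \<Sum>i\<in>?H ?k i'. p (xi i') * (?f i / P ?k i))"
        using sum.swap_restrict[of UNIV UNIV "\<lambda>i i'. p (xi i') * (?f i / P ?k i)"
            "\<lambda>i i'. i' \<in> ?H ?k i"] by (simp add: col)
      also have "\<dots> = (\<Sum>i'\<in>UNIV. \<Sum>i\<in>?H ?k i'.
          p (xi i') * x $ i' $ c / P ?k i' * (p (xi i) * w $ i $ c))"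
      proof (intro sum.cong refl)
        fix i' i assume i: "i \<in> ?H ?k i'"
        have "P ?k i = P ?k i'" unfolding P_def by (simp add: same[OF i])
        moreover have "x $ i $ c = x $ i' $ c" using x i by (auto simp: nonanticipative_def)
        ultimately show "p (xi i') * (?f i / P ?k i) =
          p (xi i') * x $ i' $ c / P ?k i' * (p (xi i) * w $ i $ c)" by simp
      qed
      also have "\<dots> = 0"
        using w unfolding M
        by (simp del: times_divide_eq_left times_divide_eq_right flip: sum_distrib_left)
      finally show ?thesis .
    qed
    then show ?thesis by (simp add: ipL)
  qed
  moreover have "w \<in> multipliers xi p stage"
    if w: "\<forall>x\<in>nonanticipative xi stage. inner_L xi p x w = 0" for w
    unfolding M
  proof (intro allI)
    fix c i
    let ?x = "(\<chi> i' c'. if c' = c \<and> i' \<in> ?H (stage c) i then 1 else 0) :: real^'n^'j"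
    have "?x \<in> nonanticipative xi stage"
      unfolding nonanticipative_def by (auto dest: same simp: sym)
    with w have "inner_L xi p ?x w = 0" by blast
    moreover have "inner_L xi p ?x w = (\<Sum>i'\<in>?H (stage c) i. p (xi i') * w $ i' $ c)"
    proof -
      have "inner_L xi p ?x w = (\<Sum>i'\<in>UNIV. p (xi i') * (?x $ i' $ c * w $ i' $ c))"
        unfolding ipL by (subst sum.remove[of _ c]) auto
      also have "\<dots> = (\<Sum>i'\<in>UNIV. if i' \<in> ?H (stage c) i then p (xi i') * w $ i' $ c else 0)"
        by (intro sum.cong) auto
      finally show ?thesis by (simp add: sum.If_cases)
    qed
    ultimately show "(\<Sum>i'\<in>?H (stage c) i. p (xi i') * w $ i' $ c) = 0" by simp
  qed
  ultimately show ?thesis by blast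
qed

end

theory Submission
  imports Defs
begin

text \<open>
  Write \<open>P\<close> for the projection onto the multiplier space. Transported by the isometry \<open>phi\<close>, the mapping
  \<open>f + s P\<close> (with \<open>f\<close> the response) has the derivative \<open>J + s Q\<close>, where \<open>J\<close> is the Jacobian of the
  embedded response and \<open>Q\<close> the matrix of the transported projection. A symmetric diagonally dominant
  matrix is positive semidefinite (\<open>diagonally_dominant_imp_psd\<close>), which applies to \<open>J + e\<^sub>3 Q\<close>;
  and since an orthogonal projection satisfies \<open>h \<bullet> Q h = \<bar>Q h\<bar>\<^sup>2 \<ge> 0\<close>, raising the level from \<open>e\<^sub>3\<close> to
  \<open>s\<close> only adds a nonnegative quadratic form. A mapping whose derivative is positive semidefinite on a
  convex set is monotone there (\<open>monotone_if_derivative_psd\<close>), so \<open>f + s P\<close> is monotone on \<open>C\<^sub>0\<close>.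

  What remains is the passage from monotonicity to maximality. A continuous monotone mapping on a
  nonempty closed convex set becomes maximal monotone once the normal cone is added
  (\<open>maximal_monotone_add_normal_cone\<close>). Its proof avoids resolvents and fixed points: a pair \<open>(x, u)\<close>
  monotonically related to the graph is tested against points of a segment issuing from \<open>x\<close> if \<open>x\<close>
  is in the set, and against a long normal vector at the nearest point otherwise.
\<close>

section \<open>Monotonicity from the derivative\<close>

text \<open>
  By the inequality of arithmetic and geometric means, an off-diagonal term \<open>A\<^sub>i\<^sub>j h\<^sub>i h\<^sub>j\<close> is at least
  \<open>- \<bar>A\<^sub>i\<^sub>j\<bar> (h\<^sub>i\<^sup>2 + h\<^sub>j\<^sup>2) / 2\<close>. Symmetry of \<open>A\<close> makes the two halves of this bound contribute equally,
  so the quadratic form is at least the sum over \<open>i\<close> of \<open>h\<^sub>i\<^sup>2\<close> times the excess of \<open>A\<^sub>i\<^sub>i\<close> over the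
  absolute sum of the rest of row \<open>i\<close>.
\<close>

lemma diagonally_dominant_imp_psd:
  fixes A :: "real^'a^'a"
  assumes sym: "transpose A = A"
    and dom: "\<And>i. (\<Sum>j\<in>UNIV - {i}. \<bar>A $ i $ j\<bar>) \<le> A $ i $ i"
  shows "0 \<le> h \<bullet> (A *v h)"
proof -
  have sym': "A $ j $ i = A $ i $ j" for i j
    using arg_cong[OF sym, of "\<lambda>B. B $ i $ j"] by (simp add: transpose_def)
  have off: "- (\<bar>A $ i $ j\<bar> * ((h $ i)\<^sup>2 + (h $ j)\<^sup>2) / 2) \<le> h $ i * (A $ i $ j * h $ j)" for i j
  proof -
    have "\<bar>h $ i * h $ j\<bar> \<le> ((h $ i)\<^sup>2 + (h $ j)\<^sup>2) / 2"
      using sum_squares_bound[of "\<bar>h $ i\<bar>" "\<bar>h $ j\<bar>"] by (simp add: abs_mult)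
    then have "\<bar>A $ i $ j\<bar> * \<bar>h $ i * h $ j\<bar> \<le> \<bar>A $ i $ j\<bar> * (((h $ i)\<^sup>2 + (h $ j)\<^sup>2) / 2)"
      by (rule mult_left_mono) simp
    then have "\<bar>h $ i * (A $ i $ j * h $ j)\<bar> \<le> \<bar>A $ i $ j\<bar> * ((h $ i)\<^sup>2 + (h $ j)\<^sup>2) / 2"
      by (simp add: abs_mult mult_ac)
    then show ?thesis by linarith
  qed
  define R where "R i = (\<Sum>j\<in>UNIV - {i}. \<bar>A $ i $ j\<bar>)" for i
  have swap: "(\<Sum>i\<in>UNIV. \<Sum>j\<in>UNIV - {i}. \<bar>A $ i $ j\<bar> * (h $ j)\<^sup>2)
      = (\<Sum>i\<in>UNIV. R i * (h $ i)\<^sup>2)"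
  proof -
    have row: "{j \<in> UNIV. i \<noteq> j} = UNIV - {i}" and col: "{i \<in> UNIV. i \<noteq> j} = UNIV - {j}"
      for i j :: 'a
      by auto
    have "(\<Sum>i\<in>UNIV. \<Sum>j\<in>UNIV - {i}. \<bar>A $ i $ j\<bar> * (h $ j)\<^sup>2)
        = (\<Sum>j\<in>UNIV. \<Sum>i\<in>UNIV - {j}. \<bar>A $ i $ j\<bar> * (h $ j)\<^sup>2)"
      using sum.swap_restrict[of UNIV UNIV "\<lambda>i j. \<bar>A $ i $ j\<bar> * (h $ j)\<^sup>2" "\<lambda>i j. i \<noteq> j",
          OF finite finite]
      by (simp only: row col)
    then show ?thesis by (simp add: R_def sum_distrib_right sym')
  qed
  have "0 \<le> (\<Sum>i\<in>UNIV. (A $ i $ i - R i) * (h $ i)\<^sup>2)"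
    by (intro sum_nonneg mult_nonneg_nonneg) (auto simp: R_def dom)
  also have "\<dots> = (\<Sum>i\<in>UNIV. A $ i $ i * (h $ i)\<^sup>2) - (\<Sum>i\<in>UNIV. R i * (h $ i)\<^sup>2)"
    by (simp add: left_diff_distrib sum_subtractf)
  also have "(\<Sum>i\<in>UNIV. R i * (h $ i)\<^sup>2)
      = ((\<Sum>i\<in>UNIV. R i * (h $ i)\<^sup>2)
          + (\<Sum>i\<in>UNIV. \<Sum>j\<in>UNIV - {i}. \<bar>A $ i $ j\<bar> * (h $ j)\<^sup>2)) / 2"
    by (simp add: swap)
  also have "\<dots> = (\<Sum>i\<in>UNIV. \<Sum>j\<in>UNIV - {i}. \<bar>A $ i $ j\<bar> * ((h $ i)\<^sup>2 + (h $ j)\<^sup>2) / 2)"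
    by (simp add: R_def sum.distrib sum_distrib_right sum_divide_distrib[symmetric] distrib_left)
  also have "(\<Sum>i\<in>UNIV. A $ i $ i * (h $ i)\<^sup>2) - \<dots>
      = (\<Sum>i\<in>UNIV. h $ i * (A $ i $ i * h $ i)
          + (\<Sum>j\<in>UNIV - {i}. - (\<bar>A $ i $ j\<bar> * ((h $ i)\<^sup>2 + (h $ j)\<^sup>2) / 2)))"
    by (simp add: sum_subtractf sum_negf power2_eq_square mult_ac)
  also have "\<dots> \<le> (\<Sum>i\<in>UNIV. h $ i * (A $ i $ i * h $ i)
      + (\<Sum>j\<in>UNIV - {i}. h $ i * (A $ i $ j * h $ j)))"
    by (intro sum_mono add_left_mono off)
  also have "\<dots> = (\<Sum>i\<in>UNIV. \<Sum>j\<in>UNIV. h $ i * (A $ i $ j * h $ j))"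
    by (intro sum.cong refl sum.remove[symmetric]) auto
  also have "\<dots> = h \<bullet> (A *v h)"
    by (simp add: inner_vec_def matrix_vector_mult_def sum_distrib_left)
  finally show ?thesis .
qed

text \<open>
  Along the segment from \<open>y\<close> to \<open>x\<close>, the real function \<open>t \<mapsto> (x - y) \<bullet> g (y + t (x - y))\<close> has derivative
  \<open>(x - y) \<bullet> g' (x - y) \<ge> 0\<close>; comparing its values at the ends gives monotonicity.
\<close>

lemma monotone_if_derivative_psd:
  fixes g :: "'v::real_inner \<Rightarrow> 'v"
  assumes "convex S"
    and der: "\<And>x. x \<in> S \<Longrightarrow> (g has_derivative g' x) (at x)"
    and psd: "\<And>x h. x \<in> S \<Longrightarrow> 0 \<le> h \<bullet> g' x h"
    and "x \<in> S" "y \<in> S"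
  shows "0 \<le> (x - y) \<bullet> (g x - g y)"
proof -
  define k where "k t = (x - y) \<bullet> g (y + t *\<^sub>R (x - y))" for t :: real
  have "k 0 \<le> k 1"
  proof (rule DERIV_nonneg_imp_nondecreasing[where f = k])
    fix t :: real assume t: "0 \<le> t" "t \<le> 1"
    let ?z = "y + t *\<^sub>R (x - y)"
    have z: "?z \<in> S"
      using convexD_alt[OF \<open>convex S\<close> \<open>y \<in> S\<close> \<open>x \<in> S\<close> t] by (simp add: algebra_simps)
    have "((\<lambda>t. y + t *\<^sub>R (x - y)) has_derivative (\<lambda>r. r *\<^sub>R (x - y))) (at t)"
      by (auto intro!: derivative_eq_intros)
    from has_derivative_compose[OF this der[OF z]]
    have "(k has_derivative (\<lambda>r. (x - y) \<bullet> g' ?z (r *\<^sub>R (x - y)))) (at t)"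
      unfolding k_def by (rule has_derivative_inner_right)
    moreover have "(\<lambda>r. (x - y) \<bullet> g' ?z (r *\<^sub>R (x - y))) = (*) ((x - y) \<bullet> g' ?z (x - y))"
      using linear_scale[OF has_derivative_linear[OF der[OF z]]] by (auto simp: fun_eq_iff)
    ultimately have "(k has_real_derivative (x - y) \<bullet> g' ?z (x - y)) (at t)"
      by (simp add: has_field_derivative_def)
    then show "\<exists>d. (k has_real_derivative d) (at t) \<and> 0 \<le> d"
      using psd[OF z] by blast
  qed simp
  then show ?thesis by (simp add: k_def inner_diff_right)
qed

section \<open>Maximal monotonicity\<close>

text \<open>
  The inner product \<open>ip\<close> is given through a linear embedding \<open>\<phi>\<close> into a Euclidean space. This
  supplies its bilinearity and definiteness as well as nearest points with respect to it: the nearest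
  point of \<open>\<phi> ` K\<close> to \<open>\<phi> x\<close> is the image of the point of \<open>K\<close> nearest to \<open>x\<close>.
\<close>

lemma maximal_monotone_add_normal_cone:
  fixes \<phi> :: "'v::euclidean_space \<Rightarrow> 'w::euclidean_space"
  assumes "linear \<phi>" "inj \<phi>" and ip: "\<And>x y. ip x y = \<phi> x \<bullet> \<phi> y"
    and K: "closed K" "convex K" "K \<noteq> {}"
    and "continuous_on K f"
    and mono: "\<And>x y. x \<in> K \<Longrightarrow> y \<in> K \<Longrightarrow> 0 \<le> ip (x - y) (f x - f y)"
  shows "maximal_monotone_mapping ip (\<lambda>x. {f x + v | v. v \<in> normal_cone ip K x})"
    (is "maximal_monotone_mapping ip ?T")
  unfolding maximal_monotone_mapping_def
proof (intro conjI allI impI)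
  interpret \<phi>: linear \<phi> by fact
  note ip_simps = ip \<phi>.add \<phi>.diff \<phi>.scale inner_simps
  show "monotone_mapping ip ?T"
    unfolding monotone_mapping_def
  proof (intro allI ballI)
    fix x y u w assume "u \<in> ?T x" "w \<in> ?T y"
    then obtain a b where "u = f x + a" "w = f y + b" "x \<in> K" "y \<in> K"
      "ip a (y - x) \<le> 0" "ip b (x - y) \<le> 0"
      by (auto simp: normal_cone_def split: if_splits)
    with mono[of x y] show "0 \<le> ip (x - y) (u - w)"
      by (simp add: ip_simps inner_commute)
  qed
  fix T' assume "monotone_mapping ip T' \<and> (\<forall>x. ?T x \<subseteq> T' x)"
  then have mono': "\<And>x y u v. u \<in> T' x \<Longrightarrow> v \<in> T' y \<Longrightarrow> 0 \<le> ip (x - y) (u - v)"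
    and sub: "\<And>x. ?T x \<subseteq> T' x"
    by (auto simp: monotone_mapping_def)
  have inT': "f y + v \<in> T' y" if "y \<in> K" "\<And>z. z \<in> K \<Longrightarrow> ip v (z - y) \<le> 0" for y v
    using sub[of y] that by (auto simp: normal_cone_def)
  have "u \<in> ?T x" if u: "u \<in> T' x" for x u
  proof -
    have x: "x \<in> K"
    proof (rule ccontr)
      assume "x \<notin> K"
      have cl: "closed (\<phi> ` K)" and cv: "convex (\<phi> ` K)" and ne: "\<phi> ` K \<noteq> {}"
        using K \<phi>.linear_axioms \<open>inj \<phi>\<close>
        by (auto intro: closed_injective_linear_image convex_linear_image)
      obtain y where y: "y \<in> K" "\<phi> y = closest_point (\<phi> ` K) (\<phi> x)"
        using closest_point_in_set[OF cl ne] by (metis imageE)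
      define a d where "a = ip (x - y) (u - f y)" and "d = ip (x - y) (x - y)"
      have "\<phi> (x - y) \<noteq> 0"
        using \<open>x \<notin> K\<close> y(1) \<open>inj \<phi>\<close> by (metis \<phi>.zero eq_iff_diff_eq_0 injD)
      then have d: "0 < d" by (simp add: d_def ip)
      \<comment> \<open>\<open>x - y\<close> is normal to \<open>K\<close> at \<open>y\<close>, hence so is every multiple \<open>r (x - y)\<close> with \<open>r \<ge> 0\<close>. Testing
        \<open>u\<close> against \<open>f y + r (x - y)\<close> gives \<open>r d \<le> a\<close>, which fails for this \<open>r\<close>.\<close>
      define r where "r = (\<bar>a\<bar> + 1) / d"
      have "f y + r *\<^sub>R (x - y) \<in> T' y"
      proof (rule inT'[OF y(1)])
        fix z assume "z \<in> K"
        then have "ip (x - y) (z - y) \<le> 0"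
          using closest_point_dot[OF cv cl, of "\<phi> z" "\<phi> x"] y(2) by (simp add: ip \<phi>.diff)
        moreover have "0 \<le> r" using d by (simp add: r_def)
        ultimately show "ip (r *\<^sub>R (x - y)) (z - y) \<le> 0"
          by (simp add: ip \<phi>.scale mult_nonneg_nonpos)
      qed
      from mono'[OF u this] have "0 \<le> a - r * d"
        by (simp add: a_def d_def ip_simps algebra_simps)
      then show False using d by (simp add: r_def)
    qed
    \<comment> \<open>Minty's argument: test against the points \<open>x + t (z - x)\<close> with \<open>0 < t < 1\<close>, divide by \<open>t\<close>, and
      let \<open>t\<close> tend to \<open>0\<close>.\<close>
    have "ip (u - f x) (z - x) \<le> 0" if z: "z \<in> K" for z
    proof -
      define q where "q t = ip (u - f (x + t *\<^sub>R (z - x))) (z - x)" for t :: real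
      have seg: "x + t *\<^sub>R (z - x) \<in> K" if "t \<in> {0..1}" for t
        using convexD_alt[OF \<open>convex K\<close> x z, of t] that by (simp add: algebra_simps)
      have "q t \<le> 0" if "t \<in> {0<..<1}" for t
      proof -
        let ?y = "x + t *\<^sub>R (z - x)"
        have "f ?y + 0 \<in> T' ?y"
          using that by (intro inT' seg) (auto simp: ip \<phi>.zero)
        from mono'[OF u this] have "0 \<le> - t * q t"
          by (simp add: q_def ip_simps inner_commute algebra_simps)
        with that show ?thesis by (simp add: zero_le_mult_iff mult_le_0_iff)
      qed
      moreover have "continuous_on {0..1} q"
        unfolding q_def ip
        by (intro continuous_intros linear_continuous_on_compose[OF _ \<open>linear \<phi>\<close>]
            continuous_on_compose2[OF \<open>continuous_on K f\<close>]) (auto intro: seg)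
      ultimately have "q 0 \<le> 0"
        by (intro continuous_le_on_closure[of "{0<..<1}" q 0 0]) auto
      then show ?thesis by (simp add: q_def)
    qed
    with x have "u - f x \<in> normal_cone ip K x" by (simp add: normal_cone_def)
    then show ?thesis by (auto intro!: exI[of _ "u - f x"])
  qed
  then show "T' = ?T" using sub by (intro ext equalityI) auto
qed

section \<open>Orthogonal projections\<close>

lemma orth_proj_eqI:
  fixes S :: "'v::euclidean_space set"
  assumes "subspace S" "y \<in> S" "\<And>z. z \<in> S \<Longrightarrow> (x - y) \<bullet> z = 0"
  shows "orth_proj (\<bullet>) S x = y"
  unfolding orth_proj_def
proof (rule the_equality)
  fix y' assume y': "y' \<in> S \<and> (\<forall>z\<in>S. (x - y') \<bullet> z = 0)"
  then have "y - y' \<in> S" using assms by (simp add: subspace_diff)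
  then have "(x - y') \<bullet> (y - y') = 0" "(x - y) \<bullet> (y - y') = 0"
    using y' assms(3) by blast+
  then have "(y - y') \<bullet> (y - y') = 0"
    by (simp add: inner_diff_left)
  then show "y' = y" by simp
qed (use assms in auto)

lemma orth_proj_in_and_orthogonal:
  fixes S :: "'v::euclidean_space set"
  assumes "subspace S"
  shows "orth_proj (\<bullet>) S x \<in> S" "z \<in> S \<Longrightarrow> (x - orth_proj (\<bullet>) S x) \<bullet> z = 0"
proof -
  obtain y w where yw: "y \<in> span S" "\<And>v. v \<in> span S \<Longrightarrow> orthogonal w v" "x = y + w"
    using orthogonal_subspace_decomp_exists[of S x] by blast
  moreover have "span S = S" using assms by (simp add: span_eq_iff)
  ultimately have "y \<in> S" and "\<And>v. v \<in> S \<Longrightarrow> (x - y) \<bullet> v = 0"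
    by (auto simp: orthogonal_def)
  moreover from this have "orth_proj (\<bullet>) S x = y" by (rule orth_proj_eqI[OF assms])
  ultimately show "orth_proj (\<bullet>) S x \<in> S" "z \<in> S \<Longrightarrow> (x - orth_proj (\<bullet>) S x) \<bullet> z = 0"
    by auto
qed

lemma linear_orth_proj:
  fixes S :: "'v::euclidean_space set"
  assumes S: "subspace S"
  shows "linear (orth_proj (\<bullet>) S)"
proof (rule linearI)
  note P = orth_proj_in_and_orthogonal[OF S]
  fix x y and r :: real
  show "orth_proj (\<bullet>) S (x + y) = orth_proj (\<bullet>) S x + orth_proj (\<bullet>) S y"
    using P(2)[of _ x] P(2)[of _ y]
    by (intro orth_proj_eqI S subspace_add P(1)) (simp add: inner_simps algebra_simps)
  show "orth_proj (\<bullet>) S (r *\<^sub>R x) = r *\<^sub>R orth_proj (\<bullet>) S x"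
    using P(2)[of _ x]
    by (intro orth_proj_eqI S subspace_scale P(1)) (simp add: inner_simps)
qed

lemma inner_orth_proj:
  fixes S :: "'v::euclidean_space set"
  assumes S: "subspace S"
  shows "x \<bullet> orth_proj (\<bullet>) S y = orth_proj (\<bullet>) S x \<bullet> orth_proj (\<bullet>) S y"
  using orth_proj_in_and_orthogonal(2)[OF S orth_proj_in_and_orthogonal(1)[OF S, of y], of x]
  by (simp add: inner_diff_left)

text \<open>
  The two conditions that characterise the projection with respect to \<open>ip\<close> are carried by \<open>\<phi>\<close> to those
  for the projection onto \<open>\<phi> ` S\<close>; injectivity makes the preimage unique, so that the definite
  description on the left denotes.
\<close>

lemma orth_proj_isometry:
  fixes \<phi> :: "'v::real_vector \<Rightarrow> 'w::euclidean_space"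
  assumes "linear \<phi>" "inj \<phi>" and ip: "\<And>x y. ip x y = \<phi> x \<bullet> \<phi> y" and S: "subspace S"
  shows "\<phi> (orth_proj ip S x) = orth_proj (\<bullet>) (\<phi> ` S) (\<phi> x)"
proof -
  interpret \<phi>: linear \<phi> by fact
  have S': "subspace (\<phi> ` S)" using \<phi>.linear_axioms S by (rule linear_subspace_image)
  obtain y where y: "y \<in> S" "\<phi> y = orth_proj (\<bullet>) (\<phi> ` S) (\<phi> x)"
    using orth_proj_in_and_orthogonal(1)[OF S', of "\<phi> x"] by (metis imageE)
  have "orth_proj ip S x = y"
    unfolding orth_proj_def
  proof (rule the_equality)
    show "y \<in> S \<and> (\<forall>z\<in>S. ip (x - y) z = 0)"
      using y orth_proj_in_and_orthogonal(2)[OF S', of _ "\<phi> x"] by (simp add: ip \<phi>.diff)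
  next
    fix y' assume "y' \<in> S \<and> (\<forall>z\<in>S. ip (x - y') z = 0)"
    then have "orth_proj (\<bullet>) (\<phi> ` S) (\<phi> x) = \<phi> y'"
      by (intro orth_proj_eqI S') (auto simp: ip \<phi>.diff)
    with y(2) \<open>inj \<phi>\<close> show "y' = y" by (metis injD)
  qed
  with y(2) show ?thesis by simp
qed

section \<open>The isometry and the embedded response\<close>

lemma linear_phi: "linear (phi xi p)"
  by (rule linearI) (simp_all add: phi_def vec_eq_iff distrib_left)

definition phi_inv ::
    "('j::finite \<Rightarrow> 's) \<Rightarrow> ('s \<Rightarrow> real) \<Rightarrow> real^('j \<times> 'n::finite) \<Rightarrow> real^'n^'j" where
  "phi_inv xi p z = (\<chi> i c. z $ (i, c) / sqrt (p (xi i)))"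

lemma linear_phi_inv: "linear (phi_inv xi p)"
  by (rule linearI) (simp_all add: phi_inv_def vec_eq_iff add_divide_distrib)

lemma phi_inv_phi:
  assumes "scenario_space N \<Xi> xi p"
  shows "phi_inv xi p (phi xi p x) = x"
  using scenario_prob_pos[OF assms] by (simp add: phi_def phi_inv_def vec_eq_iff less_imp_neq[symmetric])

lemma embedded_response_eq:
  "embedded_response xi p F z = phi xi p (response xi F (phi_inv xi p z))"
  by (simp add: embedded_response_def phi_def phi_inv_def response_def vec_eq_iff)

lemma embedded_response_differentiable:
  assumes sp: "scenario_space N \<Xi> xi p"
    and "response xi F differentiable at x"
  shows "embedded_response xi p F differentiable at (phi xi p x)"
proof -
  have "(response xi F \<circ> phi_inv xi p) differentiable at (phi xi p x)"
    by (rule differentiable_chain_at[OF linear_imp_differentiable[OF linear_phi_inv]])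
      (simp add: phi_inv_phi[OF sp] assms(2))
  then have "(phi xi p \<circ> (response xi F \<circ> phi_inv xi p)) differentiable at (phi xi p x)"
    by (intro differentiable_chain_at[OF _ linear_imp_differentiable[OF linear_phi]])
  moreover have "phi xi p \<circ> (response xi F \<circ> phi_inv xi p) = embedded_response xi p F"
    by (simp add: fun_eq_iff embedded_response_eq)
  ultimately show ?thesis by simp
qed

lemma subspace_multipliers:
  assumes "scenario_space N \<Xi> xi p"
  shows "subspace (multipliers xi p stage)"
  unfolding multipliers_eq_orthogonal_complement[OF assms] inner_phi[OF assms, symmetric] subspace_def
  by (simp add: linear_add[OF linear_phi] linear_scale[OF linear_phi] linear_0[OF linear_phi]
      inner_simps)

section \<open>Elicitation of monotonicity\<close>

theorem theorem13:
  fixes N :: nat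
    and \<Xi> :: "nat \<Rightarrow> 'a set"
    and xi :: "'j::finite \<Rightarrow> nat \<Rightarrow> 'a"
    and p :: "(nat \<Rightarrow> 'a) \<Rightarrow> real"
    and stage :: "'n::finite \<Rightarrow> nat"
    and C :: "(nat \<Rightarrow> 'a) \<Rightarrow> (real^'n) set"
    and F :: "real^'n \<Rightarrow> (nat \<Rightarrow> 'a) \<Rightarrow> real^'n"
    and C\<^sub>0 :: "(real^'n^'j) set"
    and e\<^sub>3 :: real
  assumes "1 \<le> N"
    and "scenario_space N \<Xi> xi p"
    and "range stage = {1..N}"
    and "\<And>\<xi>. \<xi> \<in> PiE {1..N} \<Xi> \<Longrightarrow> C \<xi> \<noteq> {} \<and> closed (C \<xi>) \<and> convex (C \<xi>)"
    and "constraint_set xi C \<subseteq> C\<^sub>0" and "open C\<^sub>0" and "convex C\<^sub>0"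
    and "continuously_differentiable_on (response xi F) C\<^sub>0"
    and "pseudomonotone_on (inner_L xi p) C\<^sub>0 (response xi F)"
    and "\<And>x. x \<in> phi xi p ` C\<^sub>0 \<Longrightarrow>
           transpose (jacobian (embedded_response xi p F) (at x))
             = jacobian (embedded_response xi p F) (at x)"
    and "0 < e\<^sub>3"
    and "\<And>x i. x \<in> phi xi p ` C\<^sub>0 \<Longrightarrow>
           jacobian (embedded_response xi p F) (at x) $ i $ i
             + e\<^sub>3 * multiplier_projection_matrix xi p stage $ i $ i > 0"
    and "\<And>x i. x \<in> phi xi p ` C\<^sub>0 \<Longrightarrow>
           jacobian (embedded_response xi p F) (at x) $ i $ i
             + e\<^sub>3 * multiplier_projection_matrix xi p stage $ i $ i
           > (\<Sum>j\<in>UNIV - {i}.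
               \<bar>jacobian (embedded_response xi p F) (at x) $ i $ j
                 + e\<^sub>3 * multiplier_projection_matrix xi p stage $ i $ j\<bar>)"
  shows "\<forall>s\<ge>e\<^sub>3. globally_elicited xi p stage (response xi F) (constraint_set xi C) s"
proof (intro allI impI)
  fix s assume s: "e\<^sub>3 \<le> s"
  note sp = assms(2) and dom = assms(13)
  let ?M = "multipliers xi p stage" and ?f = "response xi F" and ?G = "embedded_response xi p F"
  let ?P = "orth_proj (inner_L xi p) ?M" and ?Q = "orth_proj (\<bullet>) (phi xi p ` ?M)"
  let ?J = "\<lambda>z. jacobian ?G (at z)"
  note ip = inner_phi[OF sp, symmetric]
  have inj: "inj (phi xi p)" by (metis injI phi_inv_phi[OF sp])
  have M: "subspace (phi xi p ` ?M)"
    by (intro linear_subspace_image linear_phi subspace_multipliers[OF sp])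
  note linQ = linear_orth_proj[OF M]
  have mat: "multiplier_projection_matrix xi p stage *v h = ?Q h" for h
    unfolding multiplier_projection_matrix_def
    by (rule fun_cong[OF matrix_vector_mul(2)[OF linQ]])
  have PQ: "phi xi p (?P x) = ?Q (phi xi p x)" for x
    by (rule orth_proj_isometry[OF linear_phi inj ip subspace_multipliers[OF sp]])
  have symQ: "transpose (multiplier_projection_matrix xi p stage) = multiplier_projection_matrix xi p stage"
  proof -
    have "?Q x \<bullet> y = x \<bullet> ?Q y" for x y
      using inner_orth_proj[OF M, of x y] inner_orth_proj[OF M, of y x] by (simp add: inner_commute)
    then have "adjoint ?Q = ?Q" by (intro adjoint_unique) simp
    then show ?thesis
      unfolding multiplier_projection_matrix_def using matrix_adjoint[OF linQ] by simp
  qed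
  obtain f' where f': "\<And>x. x \<in> C\<^sub>0 \<Longrightarrow> (?f has_derivative blinfun_apply (f' x)) (at x)"
    using assms(8) unfolding continuously_differentiable_on_def by blast
  have K: "closed (constraint_set xi C)" "convex (constraint_set xi C)" "constraint_set xi C \<noteq> {}"
  proof -
    have "xi i \<in> PiE {1..N} \<Xi>" for i
      using sp unfolding scenario_space_def by (metis UNIV_I bij_betwE)
    then have C: "C (xi i) \<noteq> {}" "closed (C (xi i))" "convex (C (xi i))" for i
      using assms(4) by blast+
    have eq: "constraint_set xi C = (\<Inter>i. (\<lambda>x. x $ i) -` C (xi i))"
      by (auto simp: constraint_set_def)
    show "closed (constraint_set xi C)"
      unfolding eq by (intro closed_INT ballI continuous_closed_vimage C continuous_intros)
    show "convex (constraint_set xi C)"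
      unfolding eq using C
      by (intro convex_INT convex_linear_vimage) (auto intro: bounded_linear.linear bounded_linear_vec_nth)
    have "(\<chi> i. SOME a. a \<in> C (xi i)) \<in> constraint_set xi C"
      using C(1) by (simp add: constraint_set_def some_in_eq)
    then show "constraint_set xi C \<noteq> {}" by blast
  qed
  have contf: "continuous_on (constraint_set xi C) ?f"
    using f' assms(5) by (meson continuous_at_imp_continuous_on has_derivative_continuous subsetD)
  have linP: "linear ?P"
  proof -
    have "?P = phi_inv xi p \<circ> ?Q \<circ> phi xi p"
      by (auto simp: fun_eq_iff PQ[symmetric] phi_inv_phi[OF sp])
    then show ?thesis by (simp add: linear_compose linear_phi linear_phi_inv linQ)
  qed
  have der: "((\<lambda>z. ?G z + s *\<^sub>R ?Q z) has_derivative (\<lambda>h. ?J z *v h + s *\<^sub>R ?Q h)) (at z)"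
    if z: "z \<in> phi xi p ` C\<^sub>0" for z
  proof -
    obtain x where x: "x \<in> C\<^sub>0" "z = phi xi p x" using z by blast
    have "?G differentiable at z"
      unfolding x(2) using f'[OF x(1)]
      by (intro embedded_response_differentiable[OF sp]) (auto simp: differentiable_def)
    then have "(?G has_derivative (\<lambda>h. ?J z *v h)) (at z)" by (simp add: jacobian_works)
    then show ?thesis
      by (intro derivative_intros linear_imp_has_derivative[OF linQ])
  qed
  have psd: "0 \<le> h \<bullet> (?J z *v h + s *\<^sub>R ?Q h)" if z: "z \<in> phi xi p ` C\<^sub>0" for z h
  proof -
    let ?A = "?J z + e\<^sub>3 *\<^sub>R multiplier_projection_matrix xi p stage"
    have "0 \<le> h \<bullet> (?A *v h)"
    proof (rule diagonally_dominant_imp_psd)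
      show "transpose ?A = ?A"
        using assms(10)[OF z] symQ by (simp add: transpose_def vec_eq_iff)
      show "(\<Sum>j\<in>UNIV - {i}. \<bar>?A $ i $ j\<bar>) \<le> ?A $ i $ i" for i
        using dom[OF z, of i] by simp
    qed
    \<comment> \<open>The surplus of the level \<open>s\<close> over \<open>e\<^sub>3\<close>, where diagonal dominance is known, is harmless.\<close>
    moreover have "0 \<le> (s - e\<^sub>3) * (h \<bullet> ?Q h)"
      using s by (simp add: inner_orth_proj[OF M, of h])
    ultimately show ?thesis
      by (simp add: matrix_vector_mult_add_rdistrib scaleR_matrix_vector_assoc[symmetric] mat
          inner_simps algebra_simps)
  qed
  have mono: "0 \<le> inner_L xi p (x - y) ((?f x + s *\<^sub>R ?P x) - (?f y + s *\<^sub>R ?P y))"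
    if "x \<in> C\<^sub>0" "y \<in> C\<^sub>0" for x y
  proof -
    have "convex (phi xi p ` C\<^sub>0)" using assms(7) linear_phi by (intro convex_linear_image)
    from monotone_if_derivative_psd[OF this der psd, of "phi xi p x" "phi xi p y"] that
    show ?thesis
      by (simp add: ip PQ embedded_response_phi[OF sp] linear_diff[OF linear_phi]
          linear_add[OF linear_phi] linear_scale[OF linear_phi])
  qed
  have "maximal_monotone_mapping (inner_L xi p)
    (\<lambda>x. {(?f x + s *\<^sub>R ?P x) + v | v. v \<in> normal_cone (inner_L xi p) (constraint_set xi C) x})"
    using mono assms(5)
    by (intro maximal_monotone_add_normal_cone[OF linear_phi inj ip K] continuous_intros contf
        linear_continuous_on_compose[OF _ linP]) auto
  then show "globally_elicited xi p stage ?f (constraint_set xi C) s"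
    using s assms(11) unfolding globally_elicited_def by (simp add: add_ac)
qed

end
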